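(* Let $F$ be a marked, weighted graph with an unlooped, unmarked vertex $a$ that has standard weights, and let $\alpha(a),\beta(a),\alpha(a_m)\in R$ be universal weights for $(F,a)$ (as defined in the context). Then $$\alpha(a_m)=contr_1,\qquad \beta(a)=contr_2,\qquad \alpha(a)=(contr_3)/d,$$ where for $i=1,2,3$ $$contr_i=d^{\phi}\sum_{\substack{T\subseteq V(F-a)\\ T\text{ of type }i}}\Big(\prod_{v\in V(F-a)\setminus T}\alpha(v)\Big)\Big(\prod_{t\in T}\beta(t)\Big)d^{\nu(\mathcal{A}(F-a)_T)}$$ and $\phi$ is the number of free loops of $F$.
   Context: A graph $G=(V(G),E(G))$ is finite and may have loops, multiple edges, and free loops (connected components that contain neither vertices nor edges). A marked graph is a graph each of whose vertices is designated either marked or unmarked. A weighted, marked graph is a marked graph given with functions $\alpha,\beta:V(G)\to R$, where $R$ is a fixed commutative ring containing $A,B,d$, which are treated as independent variables; in particular $d$ and $2-d-d^2$ are not zero divisors in $R$. A vertex $v$ has standard weights if $\alpha(v)=A$ and $\beta(v)=B$. If $V(G)=\{v_1,\dots,v_n\}$, the Boolean adjacency matrix $\mathcal{A}(G)$ is the $n\times n$ matrix over $GF(2)$ with $\mathcal{A}(G)_{ii}=1$ iff $v_i$ is looped and, for $i\neq j$, $\mathcal{A}(G)_{ij}=1$ iff $v_i$ and $v_j$ are adjacent. For $T\subseteq V(G)$, $\mathcal{A}(G)_T$ is obtained from $\mathcal{A}(G)$ by first changing the $i$th diagonal entry whenever $v_i\in T$, and then removing the $i$th row and column whenever $v_i$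 is marked and the (new) $i$th diagonal entry is $0$. The weighted marked-graph bracket polynomial is $$[G]=d^{\phi}\sum_{T\subseteq V(G)}\Big(\prod_{v\notin T}\alpha(v)\Big)\Big(\prod_{t\in T}\beta(t)\Big)d^{\nu(\mathcal{A}(G)_T)},$$ where $\phi$ is the number of free loops of $G$ and $\nu$ is the $GF(2)$-nullity (the empty matrix has nullity $0$). $G-v$ is obtained by removing $v$ and all edges incident on $v$ (free loops are kept). Composition: a marked, weighted graph $G$ is the composition $F\ast H$ of marked, weighted graphs $F$ and $H$ if: (a) $V(F)\cap V(H)$ consists of a single unlooped, unmarked vertex $a$ that has standard weights in both $F$ and $H$; (b) the elements of $V(G)=V(F)\cup V(H)-\{a\}$ inherit their loops, marks and weights from $F$ and $H$; (c) $E(G)=E(F-a)\cup E(H-a)\cup\{\{v,w\} : \{v,a\}\in E(F)\text{ and }\{a,w\}\in E(H)\}$; (d) $F$ and $H$ do not share any free loop, and the free loops of $G$ are those of $F$ and $H$. Universal weights: elements $\alpha(a),\beta(a),\alpha(a_m)\in R$ are universal weights for $(F,a)$ if every composition $F\ast H$ with a marked, weighted graph $H$ in which no neighbor of $a$ is marked satisfies $[F\ast H]=[H']+[H'_m]$, where $H'$ is obtained from $H$ by changing the weights of $a$ to $\alpha(a)$ and $\beta(a)$, and $H'_m$ is obtained from $H$ by marking $a$ and changing its weights to $\alpha(a_m)$ and $0$. (Universal weights always exist. In the claim, $\alpha(a),\beta(a)$ denote these, not the standard weights of $a$ in $F$.) Types: for $T\subseteq V(F-a)$, let $\rho$ be the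 row vector over $GF(2)$ indexed by the vertices whose rows and columns are not removed in forming $\mathcal{A}(F-a)_T$, with entry $1$ at each neighbor of $a$ in $F$ and $0$ elsewhere, and let $\kappa$ be the transpose of $\rho$. It is known that the three nullities $$\nu\begin{pmatrix}\mathcal{A}(F-a)_T&\kappa\\ \rho&0\end{pmatrix},\quad \nu\begin{pmatrix}\mathcal{A}(F-a)_T&\kappa\\ \rho&1\end{pmatrix},\quad \nu(\mathcal{A}(F-a)_T)$$ are of the form $\nu+1,\nu,\nu$ in some order; $T$ is of type $1$, $2$ or $3$ according to whether the larger value $\nu+1$ appears first, second or third. (If $T$ is of type $3$ then $\nu(\mathcal{A}(F-a)_T)\geq 1$, so $contr_3$ is divisible by $d$.) *)

theory Defs
  imports
    Complex_Main
    "HOL-Library.Multiset"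
    "HOL-Library.Z2"
    "HOL-Library.Function_Algebras"
    "HOL-Library.Infinite_Typeclass"
begin

(* An edge is represented by its set of endpoints: {v, w} for a link, {v} for a loop.
   Multiple edges are repeated members of the multiset of edges. *)
record ('v, 'l, 'r) marked_graph =
  verts :: "'v set"
  edges :: "'v set multiset"
  free_loops :: "'l set"
  marked :: "'v set"
  alpha :: "'v \<Rightarrow> 'r"
  beta :: "'v \<Rightarrow> 'r"

definition wf_graph :: "('v, 'l, 'r) marked_graph \<Rightarrow> bool" where
  "wf_graph G \<longleftrightarrow> finite (verts G) \<and> finite (free_loops G) \<and> marked G \<subseteq> verts G \<and>
     (\<forall>e. e \<in># edges G \<longrightarrow> e \<subseteq> verts G \<and> (card e = 1 \<or> card e = 2))"

definition looped :: "('v, 'l, 'r) marked_graph \<Rightarrow> 'v \<Rightarrow> bool" where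
  "looped G v \<longleftrightarrow> {v} \<in># edges G"

definition adjacent :: "('v, 'l, 'r) marked_graph \<Rightarrow> 'v \<Rightarrow> 'v \<Rightarrow> bool" where
  "adjacent G v w \<longleftrightarrow> v \<noteq> w \<and> {v, w} \<in># edges G"

definition delete_vertex :: "('v, 'l, 'r) marked_graph \<Rightarrow> 'v \<Rightarrow> ('v, 'l, 'r) marked_graph" where
  "delete_vertex G v = G\<lparr>verts := verts G - {v},
     edges := filter_mset (\<lambda>e. v \<notin> e) (edges G),
     marked := marked G - {v}\<rparr>"

(* A square matrix over GF(2) is given by a finite index set I and an entry function M;
   only the entries with both indices in I count. A column vector indexed by I is a function
   vanishing outside I. *)
global_interpretation gf2: vector_space "\<lambda>(c::bit) (x::'i \<Rightarrow> bit) i. c * x i"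
  by unfold_locales (auto simp: fun_eq_iff algebra_simps)

definition null_space :: "'i set \<Rightarrow> ('i \<Rightarrow> 'i \<Rightarrow> bit) \<Rightarrow> ('i \<Rightarrow> bit) set" where
  "null_space I M = {x. (\<forall>i. i \<notin> I \<longrightarrow> x i = 0) \<and> (\<forall>i\<in>I. (\<Sum>j\<in>I. M i j * x j) = 0)}"

definition nullity :: "'i set \<Rightarrow> ('i \<Rightarrow> 'i \<Rightarrow> bit) \<Rightarrow> nat" where
  "nullity I M = gf2.dim (null_space I M)"

definition adj_matrix :: "('v, 'l, 'r) marked_graph \<Rightarrow> 'v \<Rightarrow> 'v \<Rightarrow> bit" where
  "adj_matrix G v w = (if v = w then of_bool (looped G v) else of_bool (adjacent G v w))"

(* The matrix called A(G)_T in the literature is adj_toggle G T restricted to the index set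
   kept G T. *)
definition adj_toggle :: "('v, 'l, 'r) marked_graph \<Rightarrow> 'v set \<Rightarrow> 'v \<Rightarrow> 'v \<Rightarrow> bit" where
  "adj_toggle G T v w = adj_matrix G v w + of_bool (v = w \<and> v \<in> T)"

definition kept :: "('v, 'l, 'r) marked_graph \<Rightarrow> 'v set \<Rightarrow> 'v set" where
  "kept G T = {v \<in> verts G. \<not> (v \<in> marked G \<and> adj_toggle G T v v = 0)}"

definition bracket :: "'r::comm_ring_1 \<Rightarrow> ('v, 'l, 'r) marked_graph \<Rightarrow> 'r" where
  "bracket d G = d ^ card (free_loops G) *
     (\<Sum>T | T \<subseteq> verts G. (\<Prod>v\<in>verts G - T. alpha G v) * (\<Prod>t\<in>T. beta G t) *
        d ^ nullity (kept G T) (adj_toggle G T))"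

definition has_standard_weights :: "'r \<Rightarrow> 'r \<Rightarrow> ('v, 'l, 'r) marked_graph \<Rightarrow> 'v \<Rightarrow> bool" where
  "has_standard_weights A B G v \<longleftrightarrow> alpha G v = A \<and> beta G v = B"

(* is_composition A B a F H G: G is the composition of F and H along the common vertex a.
   The elements of V(G) inherit their loops by the clause for the edges of G, since deleting a
   keeps all loops at other vertices and {v, w} in the last summand is never a loop. *)
definition is_composition ::
  "'r \<Rightarrow> 'r \<Rightarrow> 'v \<Rightarrow> ('v, 'l, 'r) marked_graph \<Rightarrow> ('v, 'l, 'r) marked_graph \<Rightarrow>
     ('v, 'l, 'r) marked_graph \<Rightarrow> bool" where
  "is_composition A B a F H G \<longleftrightarrow>
     wf_graph F \<and> wf_graph H \<and> wf_graph G \<and>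
     verts F \<inter> verts H = {a} \<and>
     \<not> looped F a \<and> \<not> looped H a \<and> a \<notin> marked F \<and> a \<notin> marked H \<and>
     has_standard_weights A B F a \<and> has_standard_weights A B H a \<and>
     verts G = (verts F \<union> verts H) - {a} \<and>
     marked G = marked F \<union> marked H \<and>
     (\<forall>v \<in> verts F - {a}. alpha G v = alpha F v \<and> beta G v = beta F v) \<and>
     (\<forall>v \<in> verts H - {a}. alpha G v = alpha H v \<and> beta G v = beta H v) \<and>
     edges G = edges (delete_vertex F a) + edges (delete_vertex H a) +
       mset_set {{v, w} | v w. {v, a} \<in># edges F \<and> {a, w} \<in># edges H} \<and>
     free_loops F \<inter> free_loops H = {} \<and>
     free_loops G = free_loops F \<union> free_loops H"

(* The vertex type and the type of free loops are infinite, so that every finite graph H has an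
   isomorphic copy that meets F only in a and shares no free loop with F. *)
definition universal_weights ::
  "'r::comm_ring_1 \<Rightarrow> 'r \<Rightarrow> 'r \<Rightarrow> ('v::infinite, 'l::infinite, 'r) marked_graph \<Rightarrow> 'v \<Rightarrow>
     'r \<Rightarrow> 'r \<Rightarrow> 'r \<Rightarrow> bool" where
  "universal_weights A B d F a \<alpha>a \<beta>a \<alpha>m \<longleftrightarrow>
     (\<forall>H G. is_composition A B a F H G \<and> (\<forall>v. adjacent H a v \<longrightarrow> v \<notin> marked H) \<longrightarrow>
        bracket d G =
          bracket d (H\<lparr>alpha := (alpha H)(a := \<alpha>a), beta := (beta H)(a := \<beta>a)\<rparr>) +
          bracket d (H\<lparr>marked := insert a (marked H),
                       alpha := (alpha H)(a := \<alpha>m), beta := (beta H)(a := 0)\<rparr>))"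

(* The matrix A(F-a)_T bordered by a row and a column for a, with corner entry c. *)
definition bordered ::
  "('v, 'l, 'r) marked_graph \<Rightarrow> 'v \<Rightarrow> 'v set \<Rightarrow> bit \<Rightarrow> 'v \<Rightarrow> 'v \<Rightarrow> bit" where
  "bordered F a T c v w =
     (if v = a \<and> w = a then c
      else if v = a then of_bool (adjacent F a w)
      else if w = a then of_bool (adjacent F a v)
      else adj_toggle (delete_vertex F a) T v w)"

definition type_nullity :: "('v, 'l, 'r) marked_graph \<Rightarrow> 'v \<Rightarrow> 'v set \<Rightarrow> nat \<Rightarrow> nat" where
  "type_nullity F a T i =
     (let K = kept (delete_vertex F a) T in
      if i = 1 then nullity (insert a K) (bordered F a T 0)
      else if i = 2 then nullity (insert a K) (bordered F a T 1)
      else nullity K (adj_toggle (delete_vertex F a) T))"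

definition of_type :: "('v, 'l, 'r) marked_graph \<Rightarrow> 'v \<Rightarrow> 'v set \<Rightarrow> nat \<Rightarrow> bool" where
  "of_type F a T i \<longleftrightarrow> i \<in> {1, 2, 3} \<and>
     (\<exists>n. type_nullity F a T i = n + 1 \<and> (\<forall>j \<in> {1, 2, 3} - {i}. type_nullity F a T j = n))"

definition contr :: "'r::comm_ring_1 \<Rightarrow> ('v, 'l, 'r) marked_graph \<Rightarrow> 'v \<Rightarrow> nat \<Rightarrow> 'r" where
  "contr d F a i = d ^ card (free_loops F) *
     (\<Sum>T | T \<subseteq> verts (delete_vertex F a) \<and> of_type F a T i.
        (\<Prod>v\<in>verts (delete_vertex F a) - T. alpha F v) * (\<Prod>t\<in>T. beta F t) *
        d ^ nullity (kept (delete_vertex F a) T) (adj_toggle (delete_vertex F a) T))"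

(* z is the quotient x / d in a ring in which d is not a zero divisor: the unique solution of
   d * z = x. *)
definition is_quotient :: "'r::comm_ring_1 \<Rightarrow> 'r \<Rightarrow> 'r \<Rightarrow> bool" where
  "is_quotient z x d \<longleftrightarrow> d * z = x"

definition zero_divisor :: "'r::comm_ring_1 \<Rightarrow> bool" where
  "zero_divisor r \<longleftrightarrow> (\<exists>x. x \<noteq> 0 \<and> r * x = 0)"

end

theory Submission
  imports Defs
begin

text \<open>The universal weights are tested on three graphs \<open>H\<close>: the single vertex \<open>a\<close>, and an edge
  joining \<open>a\<close> to a new vertex \<open>w\<close> with weights \<open>(1, 0)\<close> or \<open>(0, 1)\<close>. In the last two cases
  the matrices of \<open>F * H\<close> are those of \<open>F - a\<close> bordered by the neighbours of \<open>a\<close>, with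
  corner entry 0 or 1; so the three brackets \<open>[F * H]\<close> are sums over the three types in which one
  type each gains a factor \<open>d\<close>. The right-hand sides \<open>[H'] + [H'\<^sub>m]\<close> are the same linear forms in
  the universal weights, and the resulting system has a unique solution.

  The trichotomy of types: a bordering vector \<open>r\<close> of a symmetric matrix \<open>M\<close> over GF(2) is either
  not orthogonal to the kernel of \<open>M\<close>, in which case bordering lowers the nullity by one (type 3),
  or \<open>r = M y\<close>, in which case bordering raises the nullity by one if the corner entry equals
  \<open>r \<bullet> y\<close> and preserves it otherwise.\<close>

text \<open>These default rules rewrite \<open>+\<close> and \<open>*\<close> on \<open>bit\<close> to bit operations, out of reach of
  the ring lemmas.\<close>

declare add_bit_eq_xor [simp del] mult_bit_eq_and [simp del]

section \<open>Nullities of bordered matrices over GF(2)\<close>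

lemma bit_add_self [simp]: "b + b = (0::bit)"
  by (cases b) simp_all

lemma bit_add_eq_0_iff: "b + c = 0 \<longleftrightarrow> b = (c::bit)"
  by (cases b; cases c) simp_all

lemma bit_fun_add_self [simp]: "(x::'i \<Rightarrow> bit) + x = 0"
  by (simp add: fun_eq_iff)

lemma bit_fun_add_cancel [simp]: "(x::'i \<Rightarrow> bit) + (x + y) = y"
  by (simp flip: add.assoc)

section \<open>Null spaces as finite subspaces\<close>

lemma subspace_null_space: "gf2.subspace (null_space K M)"
proof -
  have scale: "(\<Sum>j\<in>K. M i j * (c * x j)) = c * (\<Sum>j\<in>K. M i j * x j)" for c i x
    unfolding sum_distrib_left by (intro sum.cong refl) (rule mult.left_commute)
  show ?thesis
    unfolding gf2.subspace_def null_space_def by (auto simp: distrib_left sum.distrib scale)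
qed

lemma finite_null_space:
  assumes "finite K"
  shows "finite (null_space K M)"
proof -
  have "b \<in> {0, 1}" for b :: bit
    by (cases b) simp_all
  then show ?thesis
    using finite_set_of_finite_funs[OF assms, of "{0, 1::bit}" 0]
    by (rule_tac finite_subset) (auto simp: null_space_def)
qed

lemma nullity_empty [simp]: "nullity {} M = 0"
proof -
  have "null_space {} M = {0}"
    by (auto simp: null_space_def fun_eq_iff)
  then show ?thesis
    unfolding nullity_def by (intro gf2.dim_unique[of "{}"]) (auto simp: gf2.independent_empty)
qed

text \<open>Since the only scalars are 0 and 1, adjoining \<open>x\<close> to a basis of
  \<open>V\<close> spans just \<open>V\<close> and one coset. Both bordering lemmas compare null
  spaces related in this way.\<close>

lemma gf2_dim_Un_coset:
  assumes V: "gf2.subspace V" "finite V" and x: "x \<notin> V"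
    and W: "W = V \<union> (\<lambda>v. x + v) ` V"
  shows "gf2.dim W = gf2.dim V + 1"
proof -
  obtain B where B: "B \<subseteq> V" "gf2.independent B" "V \<subseteq> gf2.span B" "card B = gf2.dim V"
    by (rule gf2.basis_exists)
  have span: "gf2.span B = V"
    using B V by (metis gf2.span_minimal subset_antisym)
  have fin: "finite B"
    using B(1) V(2) finite_subset by blast
  show ?thesis
  proof (rule gf2.dim_unique)
    show "insert x B \<subseteq> W"
      using B(1) gf2.subspace_0[OF V(1)] by (force simp: W)
    show "W \<subseteq> gf2.span (insert x B)"
      using gf2.span_mono[of B "insert x B"]
      by (auto simp: W span intro!: gf2.span_add gf2.span_base[of x])
    show "gf2.independent (insert x B)"
      using B(2) x span by (auto simp: gf2.independent_insert)
    show "card (insert x B) = gf2.dim V + 1"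
      using x B(1,4) fin by (auto simp: card_insert_if)
  qed
qed

text \<open>A functional vanishing on the common kernel of finitely many functionals is a
  combination of them. The row index set \<open>S\<close> is kept apart from \<open>K\<close> so
  that the induction removes rows while the vectors stay the same.\<close>

lemma functional_in_row_span:
  assumes "finite S"
    and "\<And>x. (\<And>i. i \<in> S \<Longrightarrow> (\<Sum>j\<in>K. m i j * x j) = 0) \<Longrightarrow> (\<Sum>j\<in>K. r j * x j) = (0::bit)"
    and "finite K"
  shows "\<exists>y. \<forall>j\<in>K. r j = (\<Sum>i\<in>S. y i * m i j)"
  using assms(1,2)
proof (induction S arbitrary: r)
  case empty
  have "r k = 0" if "k \<in> K" for k
    using empty(1)[of "\<lambda>j. of_bool (j = k)"] that \<open>finite K\<close> by (simp add: sum_mult_of_bool_eq)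
  then show ?case by simp
next
  case (insert s S)
  let ?f = "\<lambda>(g::'b \<Rightarrow> bit) x. \<Sum>j\<in>K. g j * x j"
  have add1: "?f g (\<lambda>j. x j + x' j) = ?f g x + ?f g x'" for g x x'
    by (simp add: distrib_left sum.distrib)
  have add2: "?f (\<lambda>j. g j + g' j) x = ?f g x + ?f g' x" for g g' x
    by (simp add: distrib_right sum.distrib)
  show ?case
  proof (cases "\<forall>x. (\<forall>i\<in>S. ?f (m i) x = 0) \<longrightarrow> ?f r x = 0")
    case True
    then obtain y where y: "\<forall>j\<in>K. r j = (\<Sum>i\<in>S. y i * m i j)"
      using insert.IH[of r] by auto
    have "r j = (\<Sum>i\<in>insert s S. (y(s := 0)) i * m i j)" if "j \<in> K" for j
      using insert.hyps y that by (auto intro!: sum.cong)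
    then show ?thesis by blast
  next
    case False
    then obtain x0 where x0: "\<forall>i\<in>S. ?f (m i) x0 = 0" "?f r x0 = 1"
      by auto
    then have s0: "?f (m s) x0 = 1"
      using insert.prems[of x0] by fastforce
    \<comment> \<open>If \<open>m s\<close> does not kill \<open>x\<close>, then all rows, including
      \<open>m s\<close>, kill \<open>x + x0\<close>. Hence \<open>r\<close> kills it too, and
      \<open>r\<close> and \<open>m s\<close> both take the value 1 at \<open>x\<close>.\<close>
    have "?f (\<lambda>j. r j + m s j) x = 0" if x: "\<forall>i\<in>S. ?f (m i) x = 0" for x
    proof (cases "?f (m s) x = 0")
      case True
      then show ?thesis
        using insert.prems[of x] x unfolding add2 by auto
    next
      case False
      then have "?f r (\<lambda>j. x j + x0 j) = 0"
        using x x0 s0 by (intro insert.prems) (auto simp: add1)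
      then show ?thesis
        using x0 False unfolding add1 add2 by (simp add: bit_add_eq_0_iff)
    qed
    then obtain y where y: "\<forall>j\<in>K. r j + m s j = (\<Sum>i\<in>S. y i * m i j)"
      using insert.IH[of "\<lambda>j. r j + m s j"] by auto
    have "r j = (\<Sum>i\<in>insert s S. (y(s := 1)) i * m i j)" if "j \<in> K" for j
    proof -
      have "(\<Sum>i\<in>insert s S. (y(s := 1)) i * m i j) = m s j + (\<Sum>i\<in>S. y i * m i j)"
        using insert.hyps by (auto intro!: sum.cong)
      also have "\<dots> = m s j + (r j + m s j)"
        using y that by simp
      also have "\<dots> = r j"
        by (simp add: ac_simps flip: add.assoc)
      finally show ?thesis by simp
    qed
    then show ?thesis by blast
  qed
qed

text \<open>A relation with free index \<open>p\<close> and free corner \<open>N p p\<close>: it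
  covers the bordering by \<open>a\<close> that defines the types and the bordering by a new vertex
  in a composition.\<close>

definition borders :: "'i \<Rightarrow> 'i set \<Rightarrow> ('i \<Rightarrow> 'i \<Rightarrow> bit) \<Rightarrow> ('i \<Rightarrow> bit) \<Rightarrow> ('i \<Rightarrow> 'i \<Rightarrow> bit) \<Rightarrow> bool"
  where "borders p K M r N \<longleftrightarrow>
    p \<notin> K \<and> (\<forall>i\<in>K. N i p = r i \<and> N p i = r i \<and> (\<forall>j\<in>K. N i j = M i j))"

lemma null_space_borders:
  assumes "finite K" "borders p K M r N"
  shows "x \<in> null_space (insert p K) N \<longleftrightarrow>
    (\<forall>i. i \<notin> insert p K \<longrightarrow> x i = 0) \<and>
    (\<forall>i\<in>K. (\<Sum>j\<in>K. M i j * x j) = r i * x p) \<and> (\<Sum>j\<in>K. r j * x j) = N p p * x p"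
proof -
  have p: "p \<notin> K" and N: "\<And>i. i \<in> K \<Longrightarrow> N i p = r i" "\<And>i. i \<in> K \<Longrightarrow> N p i = r i"
    "\<And>i j. i \<in> K \<Longrightarrow> j \<in> K \<Longrightarrow> N i j = M i j"
    using assms(2) by (simp_all add: borders_def)
  have "(\<Sum>j\<in>insert p K. N i j * x j) = r i * x p + (\<Sum>j\<in>K. M i j * x j)" if "i \<in> K" for i
    using p N that assms(1) by simp
  moreover have "(\<Sum>j\<in>insert p K. N p j * x j) = N p p * x p + (\<Sum>j\<in>K. r j * x j)"
    using p N assms(1) by simp
  ultimately show ?thesis
    by (simp add: null_space_def bit_add_eq_0_iff eq_commute[of "r _ * _"] eq_commute[of "N p p * _"])
       blast
qed

text \<open>By symmetry \<open>r = M y\<close> is orthogonal to the kernel of \<open>M\<close>, so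
  that kernel, extended by 0 at \<open>p\<close>, lies in the kernel of \<open>N\<close>. Any
  further kernel vector has entry 1 at \<open>p\<close> and differs from \<open>y\<close> extended
  by 1 by a kernel vector of \<open>M\<close>.\<close>

lemma nullity_borders_column_space:
  assumes K: "finite K" and sym: "\<And>i j. i \<in> K \<Longrightarrow> j \<in> K \<Longrightarrow> M i j = M j i"
    and y: "\<And>i. i \<in> K \<Longrightarrow> r i = (\<Sum>j\<in>K. M i j * y j)"
    and bd: "borders p K M r N"
  shows "nullity (insert p K) N = nullity K M + of_bool (N p p = (\<Sum>j\<in>K. r j * y j))"
proof -
  define V where "V = null_space K M"
  define W where "W = null_space (insert p K) N"
  \<comment> \<open>The only candidate up to the kernel of \<open>M\<close>: \<open>N z\<close>
    vanishes on \<open>K\<close> because \<open>M y + r = 0\<close>, and at \<open>p\<close> it is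
    the sum of \<open>N p p\<close> and the product of \<open>r\<close> and
    \<open>y\<close>.\<close>
  define z where "z = (\<lambda>i. if i = p then 1 else if i \<in> K then y i else 0)"
  have p: "p \<notin> K" using bd by (simp add: borders_def)
  have zK: "(\<Sum>j\<in>K. f j * z j) = (\<Sum>j\<in>K. f j * y j)" for f
    using p by (intro sum.cong) (auto simp: z_def)
  have orth: "(\<Sum>i\<in>K. r i * x i) = 0" if x: "\<And>i. i \<in> K \<Longrightarrow> (\<Sum>j\<in>K. M i j * x j) = 0" for x
  proof -
    have "(\<Sum>i\<in>K. r i * x i) = (\<Sum>i\<in>K. \<Sum>j\<in>K. M i j * y j * x i)"
      using y by (simp add: sum_distrib_right)
    also have "\<dots> = (\<Sum>j\<in>K. \<Sum>i\<in>K. M i j * y j * x i)"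
      by (rule sum.swap)
    also have "\<dots> = (\<Sum>j\<in>K. y j * (\<Sum>i\<in>K. M j i * x i))"
      unfolding sum_distrib_left using sym by (intro sum.cong refl) (simp add: mult_ac)
    finally show ?thesis
      using x by simp
  qed
  note W_iff = null_space_borders[OF K bd, folded W_def]
  have V_W: "x \<in> V \<longleftrightarrow> x \<in> W \<and> x p = 0" for x
    unfolding W_iff using orth[of x] p by (auto simp: V_def null_space_def)
  \<comment> \<open>On \<open>K\<close> both \<open>M x\<close> and \<open>M y\<close> equal
    \<open>r\<close>, so \<open>z + x\<close> is in the kernel of \<open>M\<close>; its
    orthogonality to \<open>r\<close> then determines the corner.\<close>
  have W_p: "N p p = (\<Sum>j\<in>K. r j * y j) \<and> z + x \<in> V" if x: "x \<in> W" "x p = 1" for x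
  proof -
    have 1: "\<And>i. i \<in> K \<Longrightarrow> (\<Sum>j\<in>K. M i j * (z + x) j) = 0"
      using x y unfolding W_iff by (simp add: distrib_left sum.distrib zK)
    then have "(\<Sum>j\<in>K. r j * (z + x) j) = 0"
      by (rule orth)
    then have "(\<Sum>j\<in>K. r j * y j) = N p p"
      using x unfolding W_iff by (simp add: distrib_left sum.distrib zK bit_add_eq_0_iff)
    moreover have "z + x \<in> V"
      using 1 x unfolding W_iff V_def null_space_def by (auto simp: z_def)
    ultimately show ?thesis by simp
  qed
  show ?thesis
  proof (cases "N p p = (\<Sum>j\<in>K. r j * y j)")
    case True
    have z: "z \<in> W"
      unfolding W_iff using y True by (auto simp: zK) (auto simp: z_def)
    have "W = V \<union> (\<lambda>v. z + v) ` V"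
    proof (intro equalityI subsetI)
      fix x assume x: "x \<in> W"
      show "x \<in> V \<union> (\<lambda>v. z + v) ` V"
      proof (cases "x p = 0")
        case False
        then show ?thesis
          using W_p[OF x] by (intro UnI2 image_eqI[of _ _ "z + x"]) auto
      qed (use V_W x in simp)
    next
      fix x assume "x \<in> V \<union> (\<lambda>v. z + v) ` V"
      then show "x \<in> W"
        using V_W z gf2.subspace_add[OF subspace_null_space, of z "insert p K" N]
        by (auto simp: W_def)
    qed
    moreover have "z \<notin> V"
      by (simp add: V_W z_def)
    ultimately show ?thesis
      using gf2_dim_Un_coset[of V z W] True K
      by (simp add: V_def W_def nullity_def subspace_null_space finite_null_space)
  next
    case False
    then have "W = V"
      using V_W W_p by fastforce
    then show ?thesis
      using False by (simp add: V_def W_def nullity_def)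
  qed
qed

text \<open>The vector \<open>x\<close> forces every kernel vector of \<open>N\<close> to vanish at
  \<open>p\<close>. So the kernel of \<open>N\<close> is the hyperplane orthogonal to
  \<open>r\<close> in the kernel of \<open>M\<close>, and \<open>x\<close> represents its other
  coset.\<close>

lemma nullity_borders_kernel:
  assumes K: "finite K" and sym: "\<And>i j. i \<in> K \<Longrightarrow> j \<in> K \<Longrightarrow> M i j = M j i"
    and x: "x \<in> null_space K M" "(\<Sum>j\<in>K. r j * x j) = 1"
    and bd: "borders p K M r N"
  shows "nullity K M = nullity (insert p K) N + 1"
proof -
  define V where "V = null_space K M"
  define W where "W = null_space (insert p K) N"
  have p: "p \<notin> K" using bd by (simp add: borders_def)
  note W_iff = null_space_borders[OF K bd, folded W_def]
  have W_p: "w p = 0" if "w \<in> W" for w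
  proof -
    \<comment> \<open>Pair the equations \<open>M w = r * w p\<close> with \<open>x\<close> and move
      \<open>M\<close> over to \<open>x\<close> by symmetry, where it gives 0.\<close>
    have "w p = w p * (\<Sum>i\<in>K. r i * x i)"
      using x(2) by simp
    also have "\<dots> = (\<Sum>i\<in>K. (r i * w p) * x i)"
      unfolding sum_distrib_left by (intro sum.cong refl) (simp add: mult_ac)
    also have "\<dots> = (\<Sum>i\<in>K. (\<Sum>j\<in>K. M i j * w j) * x i)"
      using that unfolding W_iff by simp
    also have "\<dots> = (\<Sum>i\<in>K. \<Sum>j\<in>K. M i j * w j * x i)"
      unfolding sum_distrib_right ..
    also have "\<dots> = (\<Sum>j\<in>K. \<Sum>i\<in>K. M i j * w j * x i)"
      by (rule sum.swap)
    also have "\<dots> = (\<Sum>j\<in>K. w j * (\<Sum>i\<in>K. M j i * x i))"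
      unfolding sum_distrib_left using sym by (intro sum.cong refl) (simp add: mult_ac)
    also have "\<dots> = 0"
      using x(1) by (simp add: null_space_def)
    finally show ?thesis .
  qed
  have W: "w \<in> W \<longleftrightarrow> w \<in> V \<and> (\<Sum>j\<in>K. r j * w j) = 0" for w
    using W_p[of w] p unfolding W_iff V_def null_space_def by auto
  have "V = W \<union> (\<lambda>w. x + w) ` W"
  proof (intro equalityI subsetI)
    fix v assume v: "v \<in> V"
    show "v \<in> W \<union> (\<lambda>w. x + w) ` W"
    proof (cases "v \<in> W")
      case False
      then have "(\<Sum>j\<in>K. r j * v j) = 1"
        using W v by simp
      then have "x + v \<in> W"
        using W v x gf2.subspace_add[OF subspace_null_space, of x K M v]
        by (simp add: V_def distrib_left sum.distrib)
      then show ?thesis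
        by (intro UnI2 image_eqI[of _ _ "x + v"]) auto
    qed simp
  next
    fix v assume "v \<in> W \<union> (\<lambda>w. x + w) ` W"
    then show "v \<in> V"
      using W x(1) gf2.subspace_add[OF subspace_null_space, of x K M] by (auto simp: V_def)
  qed
  moreover have "x \<notin> W"
    using W x(2) by simp
  ultimately show ?thesis
    using gf2_dim_Un_coset[of W x V] K
    by (simp add: V_def W_def nullity_def subspace_null_space finite_null_space)
qed

text \<open>The numbers \<open>n\<close> and \<open>t\<close> are fixed before \<open>p\<close> and
  \<open>N\<close>, so one type governs all borderings of \<open>M\<close> by \<open>r\<close>,
  under whatever index and with either corner entry.\<close>

lemma nullity_borders_trichotomy:
  assumes K: "finite K" and sym: "\<And>i j. i \<in> K \<Longrightarrow> j \<in> K \<Longrightarrow> M i j = M j i"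
  obtains n t where "t \<in> {1, 2, 3::nat}" "nullity K M = n + of_bool (t = 3)"
    "\<And>p N. borders p K M r N \<Longrightarrow>
       nullity (insert p K) N = n + of_bool (t = (if N p p = 0 then 1 else 2))"
proof (cases "\<exists>x\<in>null_space K M. (\<Sum>j\<in>K. r j * x j) = 1")
  case True
  then obtain x where x: "x \<in> null_space K M" "(\<Sum>j\<in>K. r j * x j) = 1" by blast
  have nul: "nullity K M = nullity (insert p K) N + 1" if "borders p K M r N" for p N
    by (rule nullity_borders_kernel[OF K _ x that]) (rule sym)
  show ?thesis
  \<comment> \<open>An existing bordering shows that \<open>nullity K M\<close> is positive, which
    makes the subtraction of 1 exact. Without one, the claim about borderings is vacuous.\<close>
  proof (cases "\<exists>p N. borders p K M r N")
    case True
    show ?thesis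
    proof (intro that[of 3 "nullity K M - 1"])
      show "nullity K M = nullity K M - 1 + of_bool (3 = (3::nat))"
        using True nul by force
      show "nullity (insert p K) N =
          nullity K M - 1 + of_bool (3 = (if N p p = 0 then 1 else 2::nat))"
        if "borders p K M r N" for p N
        using nul[OF that] by simp
    qed simp
  next
    \<comment> \<open>only when \<open>K\<close> is the whole index type\<close>
    case False
    then show ?thesis
      by (intro that[of 1 "nullity K M"]) auto
  qed
next
  case False
  have "(\<Sum>j\<in>K. r j * x j) = 0" if x: "\<And>i. i \<in> K \<Longrightarrow> (\<Sum>j\<in>K. M i j * x j) = 0" for x
  proof -
    \<comment> \<open>Members of \<open>null_space K M\<close> vanish outside \<open>K\<close>, so
      \<open>x\<close> is cut off there.\<close>
    let ?x = "\<lambda>j. if j \<in> K then x j else 0"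
    have "?x \<in> null_space K M"
      using x by (auto simp: null_space_def if_distrib[of "\<lambda>u. v * u" for v] cong: sum.cong)
    then have "(\<Sum>j\<in>K. r j * ?x j) = 0"
      using False by auto
    then show ?thesis
      by (simp cong: sum.cong)
  qed
  \<comment> \<open>The rows of \<open>M\<close> serve as the functionals; symmetry then turns the
    row combination into \<open>r = M y\<close>.\<close>
  then have "\<exists>y. \<forall>j\<in>K. r j = (\<Sum>i\<in>K. y i * M i j)"
    by (intro functional_in_row_span K) blast
  then obtain y where y': "\<forall>j\<in>K. r j = (\<Sum>i\<in>K. y i * M i j)" by blast
  have y: "r i = (\<Sum>j\<in>K. M i j * y j)" if "i \<in> K" for i
  proof -
    have "r i = (\<Sum>j\<in>K. y j * M j i)"
      using y' that by blast
    also have "\<dots> = (\<Sum>j\<in>K. M i j * y j)"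
      using sym[OF _ that] by (intro sum.cong refl) (metis mult.commute)
    finally show ?thesis .
  qed
  have nul: "nullity (insert p K) N = nullity K M + of_bool (N p p = (\<Sum>j\<in>K. r j * y j))"
    if "borders p K M r N" for p N
    by (rule nullity_borders_column_space[OF K _ _ that]) (blast intro: sym y)+
  show ?thesis
  proof (rule that[of "if (\<Sum>j\<in>K. r j * y j) = 0 then 1 else 2" "nullity K M"])
    fix p N assume "borders p K M r N"
    from nul[OF this] show "nullity (insert p K) N = nullity K M + of_bool
        ((if (\<Sum>j\<in>K. r j * y j) = 0 then 1 else 2::nat) = (if N p p = 0 then 1 else 2))"
      by (auto simp: of_bool_def)
  qed auto
qed

section \<open>Matrices of order one and two\<close>

lemma nullity_singleton: "nullity {p} M = of_bool (M p p = 0)"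
  using nullity_borders_column_space[of "{}" M "\<lambda>_. 0" "\<lambda>_. 0" p M] by (simp add: borders_def)

text \<open>Border the entry at \<open>q\<close> by \<open>p\<close>. If \<open>M q q = 0\<close>,
  the unit vector at \<open>q\<close> is a kernel vector not orthogonal to the border; if
  \<open>M q q = 1\<close>, the border is a column combination with \<open>y = 1\<close>.\<close>

lemma nullity_pair:
  assumes "p \<noteq> q" "M p q = 1" "M q p = 1"
  shows "nullity {p, q} M = of_bool (M p p = 1 \<and> M q q = 1)"
proof (cases "M q q = 0")
  case True
  then show ?thesis
    using nullity_borders_kernel[of "{q}" M "\<lambda>i. of_bool (i = q)" "\<lambda>_. 1" p M] assms
    by (simp add: borders_def null_space_def nullity_singleton)
next
  case False
  then show ?thesis
    using nullity_borders_column_space[of "{q}" M "\<lambda>_. 1" "\<lambda>_. 1" p M] assms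
    by (simp add: borders_def nullity_singleton)
qed

section \<open>Types of vertex subsets\<close>

lemma adj_toggle_sym: "adj_toggle G T u v = adj_toggle G T v u"
  by (auto simp: adj_toggle_def adj_matrix_def adjacent_def insert_commute)

lemma finite_kept: "wf_graph G \<Longrightarrow> finite (kept G T)"
  by (auto simp: kept_def wf_graph_def)

lemma delete_vertex_simps [simp]:
  "verts (delete_vertex F a) = verts F - {a}"
  "edges (delete_vertex F a) = filter_mset (\<lambda>e. a \<notin> e) (edges F)"
  "free_loops (delete_vertex F a) = free_loops F"
  "marked (delete_vertex F a) = marked F - {a}"
  "alpha (delete_vertex F a) = alpha F"
  "beta (delete_vertex F a) = beta F"
  by (simp_all add: delete_vertex_def)

lemma wf_graph_delete_vertex: "wf_graph F \<Longrightarrow> wf_graph (delete_vertex F a)"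
  by (auto simp: wf_graph_def)

text \<open>The common smaller value among the three nullities that define the type of
  \<open>T\<close>; the matrix of \<open>F - a\<close> itself exceeds it exactly in type 3.\<close>

definition core_nullity :: "('v, 'l, 'r) marked_graph \<Rightarrow> 'v \<Rightarrow> 'v set \<Rightarrow> nat" where
  "core_nullity F a T =
     nullity (kept (delete_vertex F a) T) (adj_toggle (delete_vertex F a) T)
       - of_bool (of_type F a T 3)"

text \<open>The trichotomy for the neighbours of \<open>a\<close>, as a case rule: each
  \<open>T\<close> has exactly one type, and this type predicts the nullity of every
  bordering.\<close>

lemma type_cases:
  assumes "wf_graph F"
  obtains t where "t \<in> {1, 2, 3}" "\<And>i. of_type F a T i \<longleftrightarrow> i = t"
    "nullity (kept (delete_vertex F a) T) (adj_toggle (delete_vertex F a) T) =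
       core_nullity F a T + of_bool (t = 3)"
    "\<And>p N. borders p (kept (delete_vertex F a) T) (adj_toggle (delete_vertex F a) T)
         (\<lambda>v. of_bool (adjacent F a v)) N \<Longrightarrow>
       nullity (insert p (kept (delete_vertex F a) T)) N =
         core_nullity F a T + of_bool (t = (if N p p = 0 then 1 else 2))"
proof -
  define K where "K = kept (delete_vertex F a) T"
  define M where "M = adj_toggle (delete_vertex F a) T"
  define r :: "'a \<Rightarrow> bit" where "r = (\<lambda>v. of_bool (adjacent F a v))"
  have K: "finite K"
    unfolding K_def using assms by (intro finite_kept wf_graph_delete_vertex)
  obtain n t where t: "t \<in> {1, 2, 3::nat}" and nul: "nullity K M = n + of_bool (t = 3)"
    and bd: "\<And>p N. borders p K M r N \<Longrightarrow>
       nullity (insert p K) N = n + of_bool (t = (if N p p = 0 then 1 else 2))"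
    by (rule nullity_borders_trichotomy[OF K, of M r]) (auto simp: M_def intro: adj_toggle_sym)
  \<comment> \<open>Corners 0 and 1 yield the matrices of types 1 and 2, which identifies
    \<open>t\<close> with the type.\<close>
  have b: "borders a K M r (bordered F a T c)" for c
    by (auto simp: borders_def bordered_def K_def M_def r_def kept_def)
  have "type_nullity F a T i = n + of_bool (t = i)" if "i \<in> {1, 2, 3}" for i
    using that bd[OF b[of 0]] bd[OF b[of 1]] nul
    by (auto simp: type_nullity_def bordered_def K_def[symmetric] M_def[symmetric])
  then have type: "of_type F a T i \<longleftrightarrow> i = t" for i
    using t unfolding of_type_def by auto
  have "core_nullity F a T = n"
    using type nul by (simp add: core_nullity_def K_def M_def)
  then show thesis
    using that[of t] t type nul bd by (simp add: K_def M_def r_def)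
qed

text \<open>Dividing by \<open>d\<close> is avoided by lowering the exponent for the subsets of type 3 instead.\<close>

definition core_contr :: "'r::comm_ring_1 \<Rightarrow> ('v, 'l, 'r) marked_graph \<Rightarrow> 'v \<Rightarrow> nat \<Rightarrow> 'r" where
  "core_contr d F a i = d ^ card (free_loops F) *
     (\<Sum>T | T \<subseteq> verts F - {a} \<and> of_type F a T i.
        (\<Prod>v\<in>verts F - {a} - T. alpha F v) * (\<Prod>t\<in>T. beta F t) * d ^ core_nullity F a T)"

lemma contr_eq_core_contr:
  assumes "wf_graph F"
  shows "contr d F a i = (if i = 3 then d else 1) * core_contr d F a i"
proof -
  have "d ^ nullity (kept (delete_vertex F a) T) (adj_toggle (delete_vertex F a) T) =
      (if i = 3 then d else 1) * d ^ core_nullity F a T" if "of_type F a T i" for T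
    using that by (rule_tac type_cases[OF assms, of a T]) auto
  then show ?thesis
    unfolding contr_def core_contr_def
    by (simp add: sum_distrib_left mult_ac)
qed

text \<open>The common form of the test brackets: the exponent exceeds the core nullity exactly on
  type \<open>k\<close>, so grouping by type multiplies that contribution by
  \<open>d\<close>.\<close>

lemma sum_by_type:
  assumes F: "wf_graph F" and k: "k \<in> {1, 2, 3}"
    and nu: "\<And>T. T \<subseteq> verts F - {a} \<Longrightarrow> nu T = core_nullity F a T + of_bool (of_type F a T k)"
  shows "d ^ card (free_loops F) *
      (\<Sum>T | T \<subseteq> verts F - {a}. (\<Prod>v\<in>verts F - {a} - T. alpha F v) * (\<Prod>t\<in>T. beta F t) * d ^ nu T)
    = (\<Sum>i\<in>{1, 2, 3}. (if i = k then d else 1) * core_contr d F a i)"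
proof -
  let ?P = "{T. T \<subseteq> verts F - {a}}"
  define w where
    "w T = (\<Prod>v\<in>verts F - {a} - T. alpha F v) * (\<Prod>t\<in>T. beta F t) * d ^ core_nullity F a T" for T
  have fin: "finite ?P"
    using F by (simp add: wf_graph_def)
  have core: "core_contr d F a i =
      d ^ card (free_loops F) * (\<Sum>T\<in>?P. if of_type F a T i then w T else 0)" for i
    unfolding core_contr_def w_def using fin by (simp add: sum.inter_filter[symmetric])
  have "(\<Prod>v\<in>verts F - {a} - T. alpha F v) * (\<Prod>t\<in>T. beta F t) * d ^ nu T =
      (\<Sum>i\<in>{1, 2, 3}. (if i = k then d else 1) * (if of_type F a T i then w T else 0))"
    if "T \<in> ?P" for T
  proof (rule type_cases[OF F, of a T])
    fix t :: nat
    assume "t \<in> {1, 2, 3}" and "\<And>i. of_type F a T i \<longleftrightarrow> i = t"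
    then show ?thesis
      using nu[of T] that by (auto simp: w_def mult_ac)
  qed
  then have "(\<Sum>T\<in>?P. (\<Prod>v\<in>verts F - {a} - T. alpha F v) * (\<Prod>t\<in>T. beta F t) * d ^ nu T) =
      (\<Sum>T\<in>?P. \<Sum>i\<in>{1, 2, 3}. (if i = k then d else 1) * (if of_type F a T i then w T else 0))"
    by (intro sum.cong) auto
  also have "\<dots> = (\<Sum>i\<in>{1, 2, 3}. (if i = k then d else 1) * (\<Sum>T\<in>?P. if of_type F a T i then w T else 0))"
    by (subst sum.swap) (simp only: sum_distrib_left)
  finally show ?thesis
    unfolding core
    by (simp only: sum_distrib_left[of "d ^ card (free_loops F)" _ "{1, 2, 3}"] mult.left_commute)
qed

section \<open>Test compositions\<close>

text \<open>Pairing \<open>T\<close> with \<open>insert w T\<close> isolates the weights of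
  \<open>w\<close>, whose presence in the subset decides the corner entry.\<close>

lemma bracket_split:
  assumes "finite (verts G)" "w \<in> verts G"
  shows "bracket d G = d ^ card (free_loops G) *
     (\<Sum>T | T \<subseteq> verts G - {w}. (\<Prod>v\<in>verts G - {w} - T. alpha G v) * (\<Prod>t\<in>T. beta G t) *
        (alpha G w * d ^ nullity (kept G T) (adj_toggle G T) +
         beta G w * d ^ nullity (kept G (insert w T)) (adj_toggle G (insert w T))))"
proof -
  define V where "V = verts G - {w}"
  have V: "finite V" "w \<notin> V" "verts G = insert w V"
    using assms by (auto simp: V_def)
  let ?g = "\<lambda>T. (\<Prod>v\<in>verts G - T. alpha G v) * (\<Prod>t\<in>T. beta G t) *
        d ^ nullity (kept G T) (adj_toggle G T)"
  have "(\<Sum>T\<in>Pow (insert w V). ?g T) = (\<Sum>T\<in>Pow V. ?g T) + (\<Sum>T\<in>insert w ` Pow V. ?g T)"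
    unfolding Pow_insert using V by (intro sum.union_disjoint) auto
  also have "(\<Sum>T\<in>insert w ` Pow V. ?g T) = (\<Sum>T\<in>Pow V. ?g (insert w T))"
    using V by (subst sum.reindex) (auto simp: inj_on_def)
  also have "(\<Sum>T\<in>Pow V. ?g T) + (\<Sum>T\<in>Pow V. ?g (insert w T)) =
     (\<Sum>T\<in>Pow V. (\<Prod>v\<in>V - T. alpha G v) * (\<Prod>t\<in>T. beta G t) *
        (alpha G w * d ^ nullity (kept G T) (adj_toggle G T) +
         beta G w * d ^ nullity (kept G (insert w T)) (adj_toggle G (insert w T))))"
    unfolding sum.distrib[symmetric]
  proof (intro sum.cong refl)
    fix T assume "T \<in> Pow V"
    then have T: "finite T" "w \<notin> T" "verts G - T = insert w (V - T)" "verts G - insert w T = V - T"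
      using V by (auto intro: finite_subset)
    show "?g T + ?g (insert w T) = (\<Prod>v\<in>V - T. alpha G v) * (\<Prod>t\<in>T. beta G t) *
        (alpha G w * d ^ nullity (kept G T) (adj_toggle G T) +
         beta G w * d ^ nullity (kept G (insert w T)) (adj_toggle G (insert w T)))"
      using T V by (simp add: algebra_simps)
  qed
  finally show ?thesis
    unfolding bracket_def V_def[symmetric] using V(3) by (simp add: Pow_def)
qed

text \<open>Marks and weights are parameters, so that \<open>H\<close>, \<open>H'\<close> and
  \<open>H'_m\<close> are values of one constructor.\<close>

definition vertex_graph ::
  "'v \<Rightarrow> 'v set \<Rightarrow> ('v \<Rightarrow> 'r) \<Rightarrow> ('v \<Rightarrow> 'r) \<Rightarrow> ('v, 'l, 'r) marked_graph" where
  "vertex_graph a m f g =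
     \<lparr>verts = {a}, edges = {#}, free_loops = {}, marked = m, alpha = f, beta = g\<rparr>"

definition edge_graph ::
  "'v \<Rightarrow> 'v \<Rightarrow> 'v set \<Rightarrow> ('v \<Rightarrow> 'r) \<Rightarrow> ('v \<Rightarrow> 'r) \<Rightarrow> ('v, 'l, 'r) marked_graph" where
  "edge_graph a w m f g =
     \<lparr>verts = {a, w}, edges = {#{a, w}#}, free_loops = {}, marked = m, alpha = f, beta = g\<rparr>"

lemma bracket_vertex_graph:
  "bracket d (vertex_graph a {} f g) = f a * d + g a"
  "bracket d (vertex_graph a {a} f g) = f a + g a"
proof -
  have Pow: "{T. T \<subseteq> {a}} = {{}, {a}}" by auto
  have kept: "kept (vertex_graph a {} f g) T = {a}"
    "kept (vertex_graph a {a} f g) T = (if a \<in> T then {a} else {})" for T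
    by (auto simp: kept_def vertex_graph_def adj_toggle_def adj_matrix_def looped_def)
  show "bracket d (vertex_graph a {} f g) = f a * d + g a"
    "bracket d (vertex_graph a {a} f g) = f a + g a"
    unfolding bracket_def kept
    by (simp_all add: vertex_graph_def Pow nullity_singleton adj_toggle_def adj_matrix_def looped_def)
qed

text \<open>Marking \<open>a\<close> changes only the term for the empty subset: removing
  \<open>a\<close> there leaves a zero entry at \<open>w\<close>, hence the extra factor
  \<open>d\<close>.\<close>

lemma bracket_edge_graph:
  assumes "a \<noteq> w"
  shows "bracket d (edge_graph a w {} f g) =
      f a * f w + g a * f w + f a * g w + g a * g w * d"
    and "bracket d (edge_graph a w {a} f g) =
      f a * f w * d + g a * f w + f a * g w + g a * g w * d"
proof -
  have Pow: "{T. T \<subseteq> {a, w}} = {{}, {a}, {w}, {a, w}}" by auto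
  have adj: "adj_toggle (edge_graph a w m f g) T u v =
      (if u = v then of_bool (v \<in> T) else of_bool ({u, v} = {a, w}))" for m T u v
    using assms by (auto simp: edge_graph_def adj_toggle_def adj_matrix_def looped_def adjacent_def)
  have kept: "kept (edge_graph a w {} f g) T = {a, w}"
    "kept (edge_graph a w {a} f g) T = (if a \<in> T then {a, w} else {w})" for T
    using assms by (auto simp: kept_def adj) (auto simp: edge_graph_def)
  have pair: "nullity {a, w} (adj_toggle (edge_graph a w m f g) T) = of_bool (a \<in> T \<and> w \<in> T)" for m T
    using assms by (subst nullity_pair) (auto simp: adj)
  have weights: "verts (edge_graph a w m f g) = {a, w}" "free_loops (edge_graph a w m f g) = {}"
    "alpha (edge_graph a w m f g) = f" "beta (edge_graph a w m f g) = g" for m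
    by (simp_all add: edge_graph_def)
  have diff: "{a, w} - {a} = {w}" "{a, w} - {w} = {a}"
    using assms by auto
  show "bracket d (edge_graph a w {} f g) =
      f a * f w + g a * f w + f a * g w + g a * g w * d"
    and "bracket d (edge_graph a w {a} f g) =
      f a * f w * d + g a * f w + f a * g w + g a * g w * d"
    unfolding bracket_def kept weights Pow
    using assms by (simp_all add: pair nullity_singleton adj diff doubleton_eq_iff algebra_simps)
qed

section \<open>The compositions of \<open>F\<close> with the test graphs\<close>

lemma is_composition_vertex_graph:
  fixes F :: "('v, 'l, 'r) marked_graph"
  assumes "wf_graph F" "a \<in> verts F" "\<not> looped F a" "a \<notin> marked F" "has_standard_weights A B F a"
  shows "is_composition A B a F (vertex_graph a {} (\<lambda>_. A) (\<lambda>_. B)) (delete_vertex F a)"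
proof -
  have "wf_graph (vertex_graph a {} (\<lambda>_. A) (\<lambda>_. B) :: ('v, 'l, 'r) marked_graph)"
    by (simp add: wf_graph_def vertex_graph_def)
  then show ?thesis
    using assms wf_graph_delete_vertex[OF assms(1), of a]
    by (auto simp: is_composition_def vertex_graph_def looped_def has_standard_weights_def)
qed

text \<open>The composition with an edge from \<open>a\<close> to \<open>w\<close>: the new vertex
  \<open>w\<close> takes over the neighbours of \<open>a\<close>, each joined by a single edge, with
  weights \<open>p\<close> and \<open>q\<close>.\<close>

definition join_pendant ::
  "('v, 'l, 'r) marked_graph \<Rightarrow> 'v \<Rightarrow> 'v \<Rightarrow> 'r \<Rightarrow> 'r \<Rightarrow> ('v, 'l, 'r) marked_graph" where
  "join_pendant F a w p q =
     \<lparr>verts = insert w (verts F - {a}),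
      edges = filter_mset (\<lambda>e. a \<notin> e) (edges F) + mset_set {{v, w} | v. {v, a} \<in># edges F},
      free_loops = free_loops F, marked = marked F,
      alpha = (alpha F)(w := p), beta = (beta F)(w := q)\<rparr>"

lemma edges_join_pendant:
  assumes "wf_graph F"
  shows "e \<in># edges (join_pendant F a w p q) \<longleftrightarrow>
    e \<in># edges F \<and> a \<notin> e \<or> (\<exists>v. e = {v, w} \<and> {v, a} \<in># edges F)"
proof -
  \<comment> \<open>Finiteness matters because \<open>mset_set\<close> of an infinite set is
    empty.\<close>
  have "{{v, w} | v. {v, a} \<in># edges F} \<subseteq> (\<lambda>v. {v, w}) ` verts F"
    using assms by (auto simp: wf_graph_def)
  then have "finite {{v, w} | v. {v, a} \<in># edges F}"
    using assms finite_subset by (fastforce simp: wf_graph_def)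
  then show ?thesis
    by (auto simp: join_pendant_def)
qed

lemma is_composition_edge_graph:
  fixes F :: "('v, 'l, 'r) marked_graph"
  assumes "wf_graph F" "a \<in> verts F" "\<not> looped F a" "a \<notin> marked F" "has_standard_weights A B F a"
    and w: "w \<notin> verts F"
  shows "is_composition A B a F (edge_graph a w {} ((\<lambda>_. A)(w := p)) ((\<lambda>_. B)(w := q)))
    (join_pendant F a w p q)"
proof -
  have aw: "a \<noteq> w"
    using assms by auto
  have "wf_graph (join_pendant F a w p q)"
    unfolding wf_graph_def edges_join_pendant[OF assms(1)]
  proof (intro conjI allI impI)
    fix e assume "e \<in># edges F \<and> a \<notin> e \<or> (\<exists>v. e = {v, w} \<and> {v, a} \<in># edges F)"
    \<comment> \<open>Here \<open>v = a\<close> would be a loop at \<open>a\<close>, and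
      \<open>v = w\<close> would put \<open>w\<close> into \<open>F\<close>.\<close>
    moreover have "v \<noteq> w \<and> v \<in> verts F - {a}" if "{v, a} \<in># edges F" for v
      using that assms unfolding wf_graph_def looped_def
      by (metis Diff_iff insert_absorb2 insert_subset singletonD)
    ultimately show "e \<subseteq> verts (join_pendant F a w p q)" "card e = 1 \<or> card e = 2"
      using assms(1) by (auto simp: wf_graph_def join_pendant_def)
  qed (use assms in \<open>auto simp: wf_graph_def join_pendant_def\<close>)
  moreover have "wf_graph (edge_graph a w {} ((\<lambda>_. A)(w := p)) ((\<lambda>_. B)(w := q)) :: ('v, 'l, 'r) marked_graph)"
    using aw by (auto simp: wf_graph_def edge_graph_def)
  moreover have "{{v, u} | v u. {v, a} \<in># edges F \<and> {a, u} = {a, w}} = {{v, w} | v. {v, a} \<in># edges F}"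
    using aw by (auto simp: doubleton_eq_iff)
  ultimately show ?thesis
    using assms aw
    by (auto simp: is_composition_def edge_graph_def join_pendant_def looped_def
        has_standard_weights_def doubleton_eq_iff)
qed

lemma bracket_delete_vertex:
  assumes "wf_graph F"
  shows "bracket d (delete_vertex F a) =
    core_contr d F a 1 + core_contr d F a 2 + d * core_contr d F a 3"
proof -
  have "nullity (kept (delete_vertex F a) T) (adj_toggle (delete_vertex F a) T) =
      core_nullity F a T + of_bool (of_type F a T 3)" for T
    by (rule type_cases[OF assms, of a T]) auto
  then show ?thesis
    unfolding bracket_def using sum_by_type[OF assms, of 3 a _ d] by (simp add: add.assoc)
qed

text \<open>The matrix is that of \<open>F - a\<close> bordered at \<open>w\<close> by the
  neighbours of \<open>a\<close>. As \<open>w\<close> is unlooped and unmarked, it is kept and its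
  corner entry is 1 exactly if \<open>w\<close> is in \<open>T\<close>.\<close>

lemma nullity_join_pendant:
  assumes F: "wf_graph F" and w: "w \<notin> verts F" and a: "a \<notin> marked F" "\<not> looped F a"
    and T: "T - {w} \<subseteq> verts F - {a}"
  shows "nullity (kept (join_pendant F a w p q) T) (adj_toggle (join_pendant F a w p q) T) =
    core_nullity F a (T - {w}) + of_bool (of_type F a (T - {w}) (if w \<in> T then 2 else 1))"
proof -
  let ?J = "join_pendant F a w p q" and ?D = "delete_vertex F a"
  have verts: "w \<notin> e" if "e \<in># edges F" for e
    using that F w by (auto simp: wf_graph_def)
  have noloop: "{w, a} \<notin># edges F" "{a} \<notin># edges F"
    using verts[of "{w, a}"] a by (auto simp: looped_def)
  have ww: "adj_toggle ?J T w w = of_bool (w \<in> T)"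
    using verts[of "{w}"] noloop
    by (auto simp: adj_toggle_def adj_matrix_def looped_def edges_join_pendant[OF F] insert_eq_iff)
  have vv: "adj_toggle ?J T u v = adj_toggle ?D (T - {w}) u v"
    if "u \<in> verts F - {a}" "v \<in> verts F - {a}" for u v
    using that w
    by (auto simp: adj_toggle_def adj_matrix_def looped_def adjacent_def edges_join_pendant[OF F])
  have vw: "adj_toggle ?J T v w = of_bool (adjacent F a v)" if "v \<in> verts F - {a}" for v
    using that w verts[of "{v, w}"]
    by (auto simp: adj_toggle_def adj_matrix_def looped_def adjacent_def edges_join_pendant[OF F]
        doubleton_eq_iff insert_commute)
  have "w \<notin> marked F"
    using F w by (auto simp: wf_graph_def)
  then have kept: "kept ?J T = insert w (kept ?D (T - {w}))"
    using vv a by (auto simp: kept_def) (auto simp: join_pendant_def)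
  have "borders w (kept ?D (T - {w})) (adj_toggle ?D (T - {w}))
      (\<lambda>v. of_bool (adjacent F a v)) (adj_toggle ?J T)"
    using vv vw w by (auto simp: borders_def kept_def adj_toggle_sym[of ?J T w])
  then show ?thesis
    unfolding kept by (rule_tac type_cases[OF F, of a "T - {w}"]) (auto simp: ww)
qed

text \<open>Subsets avoiding \<open>w\<close> have corner 0 and weight \<open>p\<close>, so type 1
  gains \<open>d\<close>; those containing \<open>w\<close> have corner 1 and weight
  \<open>q\<close>, so type 2 gains \<open>d\<close>.\<close>

lemma bracket_join_pendant:
  assumes F: "wf_graph F" and w: "w \<notin> verts F" and a: "a \<notin> marked F" "\<not> looped F a"
  shows "bracket d (join_pendant F a w p q) =
    p * (d * core_contr d F a 1 + core_contr d F a 2 + core_contr d F a 3) +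
    q * (core_contr d F a 1 + d * core_contr d F a 2 + core_contr d F a 3)"
proof -
  let ?J = "join_pendant F a w p q"
  let ?V = "verts F - {a}"
  let ?c = "\<lambda>T. (\<Prod>v\<in>?V - T. alpha F v) * (\<Prod>t\<in>T. beta F t)"
  let ?n = "\<lambda>i T. core_nullity F a T + of_bool (of_type F a T i)"
  have fin: "finite (verts ?J)"
    using F by (simp add: join_pendant_def wf_graph_def)
  have V: "verts ?J - {w} = ?V" "w \<in> verts ?J"
    using w by (auto simp: join_pendant_def)
  have ab: "alpha ?J w = p" "beta ?J w = q" "free_loops ?J = free_loops F"
    by (simp_all add: join_pendant_def)
  have "bracket d ?J = d ^ card (free_loops F) *
     (\<Sum>T | T \<subseteq> ?V. ?c T * (p * d ^ ?n 1 T + q * d ^ ?n 2 T))"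
    unfolding bracket_split[OF fin V(2)] V ab
  proof (intro arg_cong2[of _ _ _ _ "(*)"] refl sum.cong arg_cong2[of _ _ _ _ "(+)"], goal_cases)
    case (1 T)
    then show ?case
      using w by (intro prod.cong) (auto simp: join_pendant_def)
  next
    case (2 T)
    then show ?case
      using w by (intro prod.cong) (auto simp: join_pendant_def)
  next
    case (3 T)
    then have "w \<notin> T" "T - {w} = T"
      using w by auto
    then show ?case
      using nullity_join_pendant[OF F w a, of T] 3 by simp
  next
    case (4 T)
    then have "insert w T - {w} = T"
      using w by auto
    then show ?case
      using nullity_join_pendant[OF F w a, of "insert w T"] 4 by simp
  qed
  also have "\<dots> = p * (d ^ card (free_loops F) * (\<Sum>T | T \<subseteq> ?V. ?c T * d ^ ?n 1 T)) +
      q * (d ^ card (free_loops F) * (\<Sum>T | T \<subseteq> ?V. ?c T * d ^ ?n 2 T))"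
    by (simp only: distrib_left sum.distrib sum_distrib_left mult_ac)
  also have "d ^ card (free_loops F) * (\<Sum>T | T \<subseteq> ?V. ?c T * d ^ ?n 1 T) =
      d * core_contr d F a 1 + core_contr d F a 2 + core_contr d F a 3"
    by (subst sum_by_type[OF F, of 1]) (simp_all add: add.assoc)
  also have "d ^ card (free_loops F) * (\<Sum>T | T \<subseteq> ?V. ?c T * d ^ ?n 2 T) =
      core_contr d F a 1 + d * core_contr d F a 2 + core_contr d F a 3"
    by (subst sum_by_type[OF F, of 2]) (simp_all add: add.assoc)
  finally show ?thesis .
qed

section \<open>Solving for the universal weights\<close>

lemma not_zero_divisorD: "\<not> zero_divisor r \<Longrightarrow> r * x = 0 \<Longrightarrow> x = 0"
  by (auto simp: zero_divisor_def)

text \<open>The coefficient matrix of the system has determinant \<open>(d - 1)\<^sup>2 (d + 2)\<close>, and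
  \<open>2 - d - d\<^sup>2 = - (d - 1) (d + 2)\<close>.\<close>

lemma linear_system_trivial:
  fixes d x y z :: "'r::comm_ring_1"
  assumes d: "\<not> zero_divisor (2 - d - d ^ 2)"
    and x: "d * x + y + z = 0" and y: "x + d * y + z = 0" and z: "x + y + d * z = 0"
  shows "x = 0 \<and> y = 0 \<and> z = 0"
proof -
  have "(2 - d - d ^ 2) * x = - ((d + 1) * (d * x + y + z) - (x + d * y + z) - (x + y + d * z))"
    "(2 - d - d ^ 2) * y = - ((d + 1) * (x + d * y + z) - (d * x + y + z) - (x + y + d * z))"
    "(2 - d - d ^ 2) * z = - ((d + 1) * (x + y + d * z) - (d * x + y + z) - (x + d * y + z))"
    by (simp_all add: algebra_simps power2_eq_square)
  then show ?thesis
    unfolding x y z by (auto intro!: not_zero_divisorD[OF d])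
qed

theorem corollary21:
  fixes A B d :: "'r::comm_ring_1"
    and F :: "('v::infinite, 'l::infinite, 'r) marked_graph"
    and a :: 'v
    and \<alpha>a \<beta>a \<alpha>m :: 'r
  assumes "\<not> zero_divisor d"
    and "\<not> zero_divisor (2 - d - d ^ 2)"
    and "wf_graph F"
    and "a \<in> verts F" and "\<not> looped F a" and "a \<notin> marked F"
    and "has_standard_weights A B F a"
    and "universal_weights A B d F a \<alpha>a \<beta>a \<alpha>m"
  shows "\<alpha>m = contr d F a 1 \<and> \<beta>a = contr d F a 2 \<and> is_quotient \<alpha>a (contr d F a 3) d"
proof -
  let ?c = "core_contr d F a"
  note F = \<open>wf_graph F\<close>
  note U = \<open>universal_weights A B d F a \<alpha>a \<beta>a \<alpha>m\<close>[unfolded universal_weights_def, rule_format]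
  obtain w where w: "w \<notin> verts F"
    using F ex_new_if_finite[OF infinite_UNIV, of "verts F"] by (auto simp: wf_graph_def)
  then have aw: "a \<noteq> w"
    using assms by auto
  have "bracket d (delete_vertex F a) =
      bracket d (vertex_graph a {} ((\<lambda>_. A)(a := \<alpha>a)) ((\<lambda>_. B)(a := \<beta>a)) :: ('v, 'l, 'r) marked_graph) +
      bracket d (vertex_graph a {a} ((\<lambda>_. A)(a := \<alpha>m)) ((\<lambda>_. B)(a := 0)) :: ('v, 'l, 'r) marked_graph)"
    using U[OF conjI, OF is_composition_vertex_graph[OF assms(3-7)]]
    by (simp add: vertex_graph_def)
  then have e3: "?c 1 + ?c 2 + d * ?c 3 = \<alpha>a * d + \<beta>a + \<alpha>m"
    by (simp add: bracket_delete_vertex[OF F] bracket_vertex_graph)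
  have J: "bracket d (join_pendant F a w p q) =
      bracket d (edge_graph a w {} ((\<lambda>_. A)(w := p, a := \<alpha>a)) ((\<lambda>_. B)(w := q, a := \<beta>a)) :: ('v, 'l, 'r) marked_graph) +
      bracket d (edge_graph a w {a} ((\<lambda>_. A)(w := p, a := \<alpha>m)) ((\<lambda>_. B)(w := q, a := 0)) :: ('v, 'l, 'r) marked_graph)" for p q
    using U[OF conjI, OF is_composition_edge_graph[OF assms(3-7) w, of p q]]
    by (simp add: edge_graph_def)
  \<comment> \<open>Weights 1 and 0 at \<open>w\<close> select the subsets without \<open>w\<close>;
    the opposite choice below selects those with \<open>w\<close>.\<close>
  have e1: "d * ?c 1 + ?c 2 + ?c 3 = \<alpha>a + \<beta>a + \<alpha>m * d"
    using J[of 1 0] aw by (simp add: bracket_join_pendant[OF F w assms(6,5)] bracket_edge_graph)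
  have e2: "?c 1 + d * ?c 2 + ?c 3 = \<alpha>a + \<beta>a * d + \<alpha>m"
    using J[of 0 1] aw by (simp add: bracket_join_pendant[OF F w assms(6,5)] bracket_edge_graph)
  \<comment> \<open>The three differences solve the homogeneous system: \<open>e1\<close>,
    \<open>e2\<close> and \<open>e3\<close> carry the factor \<open>d\<close> at type 1, 2 and 3
    respectively.\<close>
  have "\<alpha>m - ?c 1 = 0 \<and> \<beta>a - ?c 2 = 0 \<and> \<alpha>a - ?c 3 = 0"
    using e1 e2 e3 by (intro linear_system_trivial[OF assms(2)]) (simp_all add: algebra_simps)
  then show ?thesis
    by (simp add: contr_eq_core_contr[OF F] is_quotient_def)
qed

end
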